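(* Let $\mathscr{T}$ be a regular T-mesh occupying a rectangle $\Omega$, and let $\mathscr{T}^{\varepsilon}$ be its extension associated with $\mathbf{S}(1,1,0,0,\mathscr{T})$. Let the crossing vertices of $\mathscr{T}^{\varepsilon}$ be $v_i$ with coordinates $(x_i,y_i)$, $i=1,\ldots,V^+$. Let $\{b_i(x,y)\}_{i=1}^{V^+}\subset\overline{\mathbf{S}}(1,1,0,0,\mathscr{T}^{\varepsilon})$ be functions satisfying $b_i(x_j,y_j)=\delta_{ij}$ for all $i,j$. Then $$\sum_{i=1}^{V^+} b_i(x,y)=1,\qquad (x,y)\in\Omega.$$
   Context: A T-mesh is a rectangular grid that allows T-junctions: a region is subdivided by finitely many horizontal and vertical segments into finitely many closed axis-parallel rectangles (the cells) with pairwise disjoint interiors. It is regular if the region $\Omega$ occupied by all its cells is a rectangle. Vertices are the grid points (corners of cells); a vertex on $\partial\Omega$ is a boundary vertex, and an interior vertex is a crossing vertex if four edges meet there and a T-vertex if exactly three edges meet there. Edges are the segments joining adjacent vertices. Extension associated with $\mathbf{S}(1,1,0,0,\mathscr{T})$: take a tensor-product mesh (a full rectangular grid) $\mathscr{M}$ with $4$ vertical and $4$ horizontal lines whose central rectangle is $\Omega$; then all edges of $\mathscr{T}$ with an endpoint on the boundary of $\mathscr{T}$ are extended (straight) to reach the boundary of $\mathscr{M}$. The resulting mesh, consisting of $\mathscr{M}$, $\mathscr{T}$ and these extended segments, is $\mathscr{T}^{\varepsilon}$. For a regular T-mesh $\mathscr{S}$ occupying a rectangle $R$, $\overline{\mathbf{S}}(1,1,0,0,\mathscr{S})$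 is the space of continuous functions on $\mathbb{R}^2$ that are bilinear polynomials (degree at most $1$ in each of $x$ and $y$) on each cell of $\mathscr{S}$ and vanish identically outside $R$. *)

theory Defs
  imports "HOL-Analysis.Analysis"
begin

definition rectangle :: "(real \<times> real) set \<Rightarrow> bool" where
  "rectangle K \<longleftrightarrow> (\<exists>a b c d. a < b \<and> c < d \<and> K = cbox (a, c) (b, d))"

text \<open>A T-mesh is represented by its set of cells. The library predicate \<open>division_of\<close> admits
  degenerate boxes, which are excluded here.\<close>

definition t_mesh :: "(real \<times> real) set set \<Rightarrow> bool" where
  "t_mesh S \<longleftrightarrow> S division_of \<Union>S \<and> (\<forall>K\<in>S. rectangle K)"

definition regular_t_mesh :: "(real \<times> real) set set \<Rightarrow> bool" where
  "regular_t_mesh S \<longleftrightarrow> t_mesh S \<and> rectangle (\<Union>S)"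

definition corners :: "(real \<times> real) set \<Rightarrow> (real \<times> real) set" where
  "corners K = {p. \<exists>a b c d. a < b \<and> c < d \<and> K = cbox (a, c) (b, d) \<and> p \<in> {a, b} \<times> {c, d}}"

definition mesh_vertices :: "(real \<times> real) set set \<Rightarrow> (real \<times> real) set" where
  "mesh_vertices S = (\<Union>K\<in>S. corners K)"

text \<open>The point set covered by the horizontal and vertical segments of the mesh.\<close>

definition mesh_grid :: "(real \<times> real) set set \<Rightarrow> (real \<times> real) set" where
  "mesh_grid S = (\<Union>K\<in>S. frontier K)"

text \<open>Two vertices are adjacent if they are joined by a horizontal or vertical piece of the grid
  that carries no further vertex. Hence a vertex lying on an edge is an endpoint of it.\<close>

definition mesh_edges :: "(real \<times> real) set set \<Rightarrow> (real \<times> real) set set" where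
  "mesh_edges S = {closed_segment p q | p q.
     p \<in> mesh_vertices S \<and> q \<in> mesh_vertices S \<and> p \<noteq> q \<and>
     (fst p = fst q \<or> snd p = snd q) \<and>
     closed_segment p q \<subseteq> mesh_grid S \<and>
     open_segment p q \<inter> mesh_vertices S = {}}"

definition crossing_vertices :: "(real \<times> real) set set \<Rightarrow> (real \<times> real) set" where
  "crossing_vertices S =
     {p \<in> mesh_vertices S. p \<in> interior (\<Union>S) \<and> card {e \<in> mesh_edges S. p \<in> e} = 4}"

definition tensor_mesh ::
  "nat \<Rightarrow> nat \<Rightarrow> (nat \<Rightarrow> real) \<Rightarrow> (nat \<Rightarrow> real) \<Rightarrow> (real \<times> real) set set" where
  "tensor_mesh m n xs ys =
     {cbox (xs i, ys j) (xs (Suc i), ys (Suc j)) | i j. Suc i < m \<and> Suc j < n}"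

text \<open>\<open>M\<close> is a tensor-product mesh with 4 vertical and 4 horizontal lines (indexed from 0) whose
  central rectangle is \<open>\<Omega>\<close>.\<close>

definition frame_mesh :: "(real \<times> real) set \<Rightarrow> (real \<times> real) set set \<Rightarrow> bool" where
  "frame_mesh \<Omega> M \<longleftrightarrow> (\<exists>xs ys. strict_mono_on {..<4} xs \<and> strict_mono_on {..<4} ys \<and>
     M = tensor_mesh 4 4 xs ys \<and> \<Omega> = cbox (xs 1, ys 1) (xs 2, ys 2))"

text \<open>The edge from \<open>p\<close> to the boundary vertex \<open>q\<close> is prolonged straight beyond \<open>q\<close> up to the
  point \<open>r\<close> on the boundary of \<open>M\<close>. For edges contained in the boundary of the region of \<open>T\<close> this
  only yields parts of lines of \<open>M\<close>.\<close>

definition extension_segments ::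
  "(real \<times> real) set set \<Rightarrow> (real \<times> real) set set \<Rightarrow> (real \<times> real) set set" where
  "extension_segments M T = {closed_segment q r | p q r.
     closed_segment p q \<in> mesh_edges T \<and> q \<in> frontier (\<Union>T) \<and>
     r \<in> frontier (\<Union>M) \<and> q \<in> open_segment p r}"

text \<open>\<open>Te\<close> is the extension of \<open>T\<close> (with respect to the frame \<open>M\<close>): the mesh whose segments are
  those of \<open>M\<close>, those of \<open>T\<close> and the prolongations. A T-mesh is determined by its region and its
  grid, as the cells are the closures of the components of the complement of the grid.\<close>

definition is_extension ::
  "(real \<times> real) set set \<Rightarrow> (real \<times> real) set set \<Rightarrow> (real \<times> real) set set \<Rightarrow> bool" where
  "is_extension M T Te \<longleftrightarrow> frame_mesh (\<Union>T) M \<and> regular_t_mesh Te \<and> \<Union>Te = \<Union>M \<and>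
     mesh_grid Te = mesh_grid M \<union> mesh_grid T \<union> \<Union>(extension_segments M T)"

definition bilinear_on :: "(real \<times> real) set \<Rightarrow> (real \<times> real \<Rightarrow> real) \<Rightarrow> bool" where
  "bilinear_on K f \<longleftrightarrow>
     (\<exists>a b c d. \<forall>x y. (x, y) \<in> K \<longrightarrow> f (x, y) = a + b * x + c * y + d * x * y)"

text \<open>The space of splines of bidegree (1,1) and smoothness (0,0) with homogeneous boundary
  conditions.\<close>

definition Sbar_1100 :: "(real \<times> real) set set \<Rightarrow> (real \<times> real \<Rightarrow> real) set" where
  "Sbar_1100 S = {f. continuous_on UNIV f \<and> (\<forall>K\<in>S. bilinear_on K f) \<and> (\<forall>p. p \<notin> \<Union>S \<longrightarrow> f p = 0)}"

end

theory Submission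
  imports Defs
begin

text \<open>
  The theorem is an instance of a discrete maximum principle. Let \<open>f\<close> be continuous and bilinear on
  every cell, and let \<open>p\<close> be a point of \<open>\<Omega>\<close> that is not a crossing vertex. Then some cell contains
  \<open>p\<close> without having it as a corner (lemma \<open>crossing_vertex_if_always_corner\<close>): \<open>p\<close> is inside this
  cell or inside one of its sides, and \<open>f\<close> is affine on a short horizontal or vertical segment
  centred at \<open>p\<close>. At a T-vertex this segment is part of the bar of the T. If
  \<open>f\<close> attains its maximum over \<open>\<Omega>\<close> at \<open>p\<close>, it also attains it at both ends of the segment, and
  one of them is further to the right or further up. So a maximum point at which \<open>x + y\<close> is largest
  has to be a crossing vertex, and \<open>f\<close> is bounded on \<open>\<Omega>\<close> by its values at the crossing vertices
  (lemma \<open>spline_le_if_le_at_crossing_vertices\<close>). Choosing the extremal point in this way also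
  copes with T-vertices that depend on each other cyclically.

  The frame serves to keep the short segment inside \<open>\<Omega>\<close>. As the mesh lines through the sides of
  \<open>\<Omega>\<close> continue beyond the corners of \<open>\<Omega>\<close>, no cell straddles one of these lines.

  The theorem follows from the principle for \<open>f = (\<Sum>i. b i)\<close> and for \<open>- f\<close>, since \<open>f\<close> has the value
  1 at every crossing vertex.
\<close>

section \<open>Cells, corners and the grid\<close>

lemma t_mesh_cellE:
  assumes "t_mesh S" "K \<in> S"
  obtains a b c d where "a < b" "c < d" "K = cbox (a, c) (b, d)"
proof -
  have "rectangle K"
    using assms by (simp add: t_mesh_def)
  then show thesis
    using that unfolding rectangle_def by (elim exE conjE)
qed

lemma corners_cbox:
  fixes a b c d :: real
  assumes "a < b" "c < d"
  shows "corners (cbox (a, c) (b, d)) = {a, b} \<times> {c, d}"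
proof -
  have "a' = a \<and> b' = b \<and> c' = c \<and> d' = d"
    if "a' < b'" "c' < d'" "cbox (a, c) (b, d) = cbox (a', c') (b', d')" for a' b' c' d' :: real
  proof -
    have "cbox (a, c) (b, d) \<noteq> {}"
      using assms by (simp add: cbox_Pair_eq)
    then show ?thesis
      using that(3) unfolding eq_cbox by simp
  qed
  note unique = this
  show ?thesis
  proof (intro equalityI subsetI)
    fix p assume "p \<in> corners (cbox (a, c) (b, d))"
    then obtain a' b' c' d' where "a' < b'" "c' < d'" "cbox (a, c) (b, d) = cbox (a', c') (b', d')"
      and p: "p \<in> {a', b'} \<times> {c', d'}"
      unfolding corners_def by force
    from unique[OF this(1-3)] p show "p \<in> {a, b} \<times> {c, d}"
      by simp
  next
    fix p assume "p \<in> {a, b} \<times> {c, d}"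
    with assms show "p \<in> corners (cbox (a, c) (b, d))"
      unfolding corners_def mem_Collect_eq
      by (intro exI[of _ a] exI[of _ b] exI[of _ c] exI[of _ d] conjI refl)
  qed
qed

lemma finite_mesh_vertices:
  assumes "t_mesh S"
  shows "finite (mesh_vertices S)"
proof -
  have "finite (corners K)" if "K \<in> S" for K
    by (rule t_mesh_cellE[OF assms that]) (simp add: corners_cbox)
  moreover have "finite S"
    using assms unfolding t_mesh_def by (auto simp: division_of_def)
  ultimately show ?thesis
    unfolding mesh_vertices_def by blast
qed

lemma mem_frontier_cbox_Pair:
  fixes a b c d x y :: real
  shows "(x, y) \<in> frontier (cbox (a, c) (b, d)) \<longleftrightarrow>
    (x, y) \<in> cbox (a, c) (b, d) \<and> (x = a \<or> x = b \<or> y = c \<or> y = d)"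
  by (auto simp: frontier_cbox mem_box Basis_prod_def)

lemma interior_cell_disjoint_mesh_grid:
  assumes "t_mesh S" "K \<in> S"
  shows "interior K \<inter> mesh_grid S = {}"
proof -
  have "interior K \<inter> frontier L = {}" if L: "L \<in> S" for L
  proof (cases "L = K")
    case True
    then show ?thesis by (auto simp: frontier_def)
  next
    case False
    then have "interior K \<inter> interior L = {}"
      using assms L division_ofD(5)[of S "\<Union>S"] unfolding t_mesh_def by blast
    then have "interior K \<inter> closure (interior L) = {}"
      by (simp add: open_Int_closure_eq_empty)
    moreover obtain a b c d where "a < b" "c < d" "L = cbox (a, c) (b, d)"
      using t_mesh_cellE[OF assms(1) L] .
    then have "closure (interior L) = L"
      by (simp add: interior_cbox closure_box box_ne_empty Basis_prod_def)
    ultimately show ?thesis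
      using frontier_subset_closed[of L] \<open>L = cbox (a, c) (b, d)\<close> by (auto simp: closed_cbox)
  qed
  then show ?thesis
    unfolding mesh_grid_def by blast
qed

section \<open>Recognising crossing vertices\<close>

text \<open>As the closed cells are finitely many, those that avoid \<open>p\<close> stay away from it.\<close>

lemma cells_near_point_contain_it:
  assumes S: "t_mesh S" and p: "p \<in> interior (\<Union>S)"
  obtains \<delta> where "\<delta> > 0" "\<And>z. dist p z < \<delta> \<Longrightarrow> \<exists>K\<in>S. z \<in> K \<and> p \<in> K"
proof -
  let ?C = "\<Union>{K \<in> S. p \<notin> K}"
  have "finite S"
    using S by (auto simp: t_mesh_def division_of_def)
  moreover have "closed K" if "K \<in> S" for K
    by (rule t_mesh_cellE[OF S that]) (simp add: closed_cbox)
  ultimately have "closed ?C"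
    by (intro closed_Union) auto
  then have "open (interior (\<Union>S) - ?C)"
    by (simp add: open_Diff)
  moreover have "p \<in> interior (\<Union>S) - ?C"
    using p by auto
  ultimately obtain \<delta> where "\<delta> > 0" "ball p \<delta> \<subseteq> interior (\<Union>S) - ?C"
    by (meson openE)
  moreover have "\<exists>K\<in>S. z \<in> K \<and> p \<in> K" if "z \<in> interior (\<Union>S) - ?C" for z
    using that interior_subset[of "\<Union>S"] by blast
  ultimately show thesis
    using that[of \<delta>] by (meson mem_ball subsetD)
qed

definition directions :: "(real \<times> real) set" where
  "directions = {(1, 0), (-1, 0), (0, 1), (0, -1)}"

lemma direction_of_axis_parallel:
  fixes p q :: "real \<times> real"
  assumes "p \<noteq> q" "fst p = fst q \<or> snd p = snd q"
  obtains e t where "e \<in> directions" "t > 0" "q = p + t *\<^sub>R e"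
proof -
  obtain x y x' y' where pq: "p = (x, y)" "q = (x', y')"
    by fastforce
  consider "x < x'" "y = y'" | "x > x'" "y = y'" | "x = x'" "y < y'" | "x = x'" "y > y'"
    using assms pq by fastforce
  then show thesis
  proof cases
    case 1 then show ?thesis using that[of "(1, 0)" "x' - x"] pq by (simp add: directions_def)
  next
    case 2 then show ?thesis using that[of "(-1, 0)" "x - x'"] pq by (simp add: directions_def)
  next
    case 3 then show ?thesis using that[of "(0, 1)" "y' - y"] pq by (simp add: directions_def)
  next
    case 4 then show ?thesis using that[of "(0, -1)" "y - y'"] pq by (simp add: directions_def)
  qed
qed

lemma ray_in_open_segment:
  fixes p e :: "'a :: real_vector"
  assumes "0 < s" "s < t" "e \<noteq> 0"
  shows "p + s *\<^sub>R e \<in> open_segment p (p + t *\<^sub>R e)"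
  unfolding in_segment
proof (intro conjI exI)
  show "0 < s / t" "s / t < 1"
    using assms by auto
  show "p + s *\<^sub>R e = (1 - s / t) *\<^sub>R p + (s / t) *\<^sub>R (p + t *\<^sub>R e)"
    using assms by (simp add: algebra_simps)
qed (use assms in auto)

lemma open_segment_rayE:
  fixes p e :: "'a :: real_vector"
  assumes "z \<in> open_segment p (p + t *\<^sub>R e)" "t > 0"
  obtains s where "0 < s" "s < t" "z = p + s *\<^sub>R e"
proof -
  obtain u where u: "0 < u" "u < 1" "z = (1 - u) *\<^sub>R p + u *\<^sub>R (p + t *\<^sub>R e)"
    using assms(1) unfolding in_segment by blast
  have "z = p + (u * t) *\<^sub>R e"
    using u(3) by (simp add: algebra_simps)
  moreover have "0 < u * t" "u * t < t"
    using u assms(2) by auto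
  ultimately show thesis
    using that by blast
qed

text \<open>In each direction the edge at \<open>p\<close> is the one that leads to the nearest vertex. Hence the
  edges at \<open>p\<close> correspond to the directions.\<close>

lemma card_edges_at_vertex:
  assumes S: "t_mesh S" and p: "p \<in> mesh_vertices S"
    and arms: "\<And>e. e \<in> directions \<Longrightarrow>
      \<exists>t>0. p + t *\<^sub>R e \<in> mesh_vertices S \<and> closed_segment p (p + t *\<^sub>R e) \<subseteq> mesh_grid S"
  shows "card {E \<in> mesh_edges S. p \<in> E} = 4"
proof -
  define Q where "Q e = {t. 0 < t \<and> p + t *\<^sub>R e \<in> mesh_vertices S}" for e
  define q where "q e = p + Min (Q e) *\<^sub>R e" for e
  have nz: "e \<noteq> 0" if "e \<in> directions" for e
    using that by (auto simp: directions_def zero_prod_def)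
  have finQ: "finite (Q e)" if "e \<in> directions" for e
  proof (rule finite_subset)
    show "Q e \<subseteq> (\<lambda>t. p + t *\<^sub>R e) -` mesh_vertices S"
      unfolding Q_def by auto
    show "finite ((\<lambda>t. p + t *\<^sub>R e) -` mesh_vertices S)"
      using finite_mesh_vertices[OF S] nz[OF that] by (intro finite_vimageI) (auto simp: inj_def)
  qed
  have MinQ: "Min (Q e) \<in> Q e" if "e \<in> directions" for e
    using arms[OF that] finQ[OF that] by (intro Min_in) (auto simp: Q_def)
  have edge: "closed_segment p (q e) \<in> mesh_edges S" if e: "e \<in> directions" for e
  proof -
    obtain t where t: "t > 0" "p + t *\<^sub>R e \<in> mesh_vertices S"
      "closed_segment p (p + t *\<^sub>R e) \<subseteq> mesh_grid S"
      using arms[OF e] by blast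
    have "Min (Q e) \<le> t"
      using t finQ[OF e] by (intro Min_le) (auto simp: Q_def)
    then have "q e \<in> closed_segment p (p + t *\<^sub>R e)"
      using MinQ[OF e] ray_in_open_segment[of "Min (Q e)" t e p] nz[OF e]
      by (cases "Min (Q e) = t") (auto simp: q_def Q_def open_segment_def)
    then have "closed_segment p (q e) \<subseteq> mesh_grid S"
      using t(3) by (meson ends_in_segment(1) subset_closed_segment subset_trans)
    moreover have "open_segment p (q e) \<inter> mesh_vertices S = {}"
    proof -
      have False if z: "z \<in> open_segment p (q e)" "z \<in> mesh_vertices S" for z
      proof -
        obtain s where "0 < s" "s < Min (Q e)" "z = p + s *\<^sub>R e"
          using open_segment_rayE[OF z(1)[unfolded q_def]] MinQ[OF e] unfolding Q_def by blast
        then show False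
          using z(2) Min_le[OF finQ[OF e], of s] by (auto simp: Q_def)
      qed
      then show ?thesis by blast
    qed
    moreover have "q e \<in> mesh_vertices S" "p \<noteq> q e"
      using MinQ[OF e] nz[OF e] by (auto simp: Q_def q_def)
    moreover have "fst p = fst (q e) \<or> snd p = snd (q e)"
      using e by (auto simp: q_def directions_def)
    ultimately show ?thesis
      unfolding mesh_edges_def using p by blast
  qed
  have all: "E \<in> (\<lambda>e. closed_segment p (q e)) ` directions"
    if E: "E \<in> mesh_edges S" "p \<in> E" for E
  proof -
    obtain r s where rs: "E = closed_segment r s" "r \<in> mesh_vertices S" "s \<in> mesh_vertices S"
      "r \<noteq> s" "fst r = fst s \<or> snd r = snd s" "open_segment r s \<inter> mesh_vertices S = {}"
      using E(1) unfolding mesh_edges_def by blast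
    have "p = r \<or> p = s"
      using rs E(2) p by (auto simp: open_segment_def)
    then obtain w where w: "E = closed_segment p w" "w \<in> mesh_vertices S" "p \<noteq> w"
      "fst p = fst w \<or> snd p = snd w" "open_segment p w \<inter> mesh_vertices S = {}"
      using rs by (metis closed_segment_commute open_segment_commute)
    obtain e t where et: "e \<in> directions" "t > 0" "w = p + t *\<^sub>R e"
      using direction_of_axis_parallel[OF w(3,4)] .
    have "Min (Q e) \<le> t"
      using et w(2) finQ[OF et(1)] by (intro Min_le) (auto simp: Q_def)
    moreover have "\<not> Min (Q e) < t"
      using ray_in_open_segment[of "Min (Q e)" t e p] MinQ[OF et(1)] nz[OF et(1)] w(5) et(3)
      by (auto simp: Q_def)
    ultimately have "w = q e"
      using et(3) by (simp add: q_def)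
    then show ?thesis
      using w(1) et(1) by blast
  qed
  have "inj_on (\<lambda>e. closed_segment p (q e)) directions"
  proof (rule inj_onI)
    fix e e' assume e: "e \<in> directions" "e' \<in> directions"
      and eq: "closed_segment p (q e) = closed_segment p (q e')"
    have "q e = q e'"
      using eq by (auto simp: closed_segment_eq doubleton_eq_iff)
    moreover have "Min (Q e) > 0" "Min (Q e') > 0"
      using MinQ e by (auto simp: Q_def)
    ultimately show "e = e'"
      using e by (auto simp: q_def directions_def)
  qed
  moreover have "{E \<in> mesh_edges S. p \<in> E} = (\<lambda>e. closed_segment p (q e)) ` directions"
    using edge all by auto
  moreover have "card directions = 4"
    by (simp add: directions_def)
  ultimately show ?thesis
    by (simp add: card_image)
qed

lemma closed_segment_cbox_side:
  fixes a b c d :: real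
  assumes "u \<in> corners (cbox (a, c) (b, d))" "w \<in> corners (cbox (a, c) (b, d))"
    "fst u = fst w \<or> snd u = snd w" "a < b" "c < d"
  shows "closed_segment u w \<subseteq> frontier (cbox (a, c) (b, d))"
proof
  fix z assume z: "z \<in> closed_segment u w"
  have uw: "u \<in> {a, b} \<times> {c, d}" "w \<in> {a, b} \<times> {c, d}"
    using assms(1,2) corners_cbox[OF assms(4,5)] by auto
  then have "u \<in> cbox (a, c) (b, d)" "w \<in> cbox (a, c) (b, d)"
    using assms(4,5) by (auto simp: cbox_Pair_eq)
  then have "z \<in> cbox (a, c) (b, d)"
    using z closed_segment_subset[of u "cbox (a, c) (b, d)" w] convex_box(1) by blast
  moreover have "fst z = fst u \<or> snd z = snd u"
  proof -
    obtain t where "z = (1 - t) *\<^sub>R u + t *\<^sub>R w"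
      using z unfolding in_segment by blast
    then have "fst z = (1 - t) * fst u + t * fst w" "snd z = (1 - t) * snd u + t * snd w"
      by simp_all
    with assms(3) show ?thesis
      by (auto simp: algebra_simps)
  qed
  ultimately show "z \<in> frontier (cbox (a, c) (b, d))"
    using uw by (cases z) (auto simp: mem_frontier_cbox_Pair)
qed

text \<open>The cell reaching into the upper right quadrant at \<open>p\<close> has \<open>p\<close> as its lower left corner and
  contributes the arms to the right and upwards. The cell in the opposite quadrant contributes the
  other two arms.\<close>

lemma crossing_vertex_if_always_corner:
  assumes S: "t_mesh S" and p: "p \<in> interior (\<Union>S)"
    and corner: "\<And>K. K \<in> S \<Longrightarrow> p \<in> K \<Longrightarrow> p \<in> corners K"
  shows "p \<in> crossing_vertices S"
proof -
  obtain x y where xy: "p = (x, y)"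
    by fastforce
  obtain \<delta> where \<delta>: "\<delta> > 0" "\<And>z. dist p z < \<delta> \<Longrightarrow> \<exists>K\<in>S. z \<in> K \<and> p \<in> K"
    using cells_near_point_contain_it[OF S p] by blast
  have "\<exists>K\<in>S. (x + \<delta>/3, y + \<delta>/3) \<in> K \<and> p \<in> K" "\<exists>K\<in>S. (x - \<delta>/3, y - \<delta>/3) \<in> K \<and> p \<in> K"
  proof -
    have "dist p (x + \<sigma>, y + \<sigma>) \<le> \<bar>\<sigma>\<bar> + \<bar>\<sigma>\<bar>" for \<sigma>
      using sqrt_sum_squares_le_sum_abs[of \<sigma> \<sigma>] by (simp add: xy dist_Pair_Pair dist_real_def)
    from this[of "\<delta>/3"] this[of "- \<delta>/3"]
    show "\<exists>K\<in>S. (x + \<delta>/3, y + \<delta>/3) \<in> K \<and> p \<in> K" "\<exists>K\<in>S. (x - \<delta>/3, y - \<delta>/3) \<in> K \<and> p \<in> K"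
      using \<delta>(1) by (auto intro!: \<delta>(2))
  qed
  then obtain K L where K: "K \<in> S" "(x + \<delta>/3, y + \<delta>/3) \<in> K" "p \<in> K"
    and L: "L \<in> S" "(x - \<delta>/3, y - \<delta>/3) \<in> L" "p \<in> L"
    by blast
  obtain a b c d where abcd: "a < b" "c < d" "K = cbox (a, c) (b, d)"
    using t_mesh_cellE[OF S K(1)] .
  obtain a' b' c' d' where abcd': "a' < b'" "c' < d'" "L = cbox (a', c') (b', d')"
    using t_mesh_cellE[OF S L(1)] .
  have pK: "x = a" "y = c" and pL: "x = b'" "y = d'"
    using corner[OF K(1,3)] corner[OF L(1,3)] K(2) L(2) abcd abcd' corners_cbox \<delta>(1)
    by (auto simp: cbox_Pair_eq xy)
  have pv: "p \<in> mesh_vertices S"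
    using corner[OF K(1,3)] K(1) unfolding mesh_vertices_def by blast
  have arm: "\<exists>t>0. p + t *\<^sub>R e \<in> mesh_vertices S \<and> closed_segment p (p + t *\<^sub>R e) \<subseteq> mesh_grid S"
    if N: "N \<in> S" "p \<in> N" and e: "t > 0" "p + t *\<^sub>R e \<in> corners N" "e \<in> directions" for N t e
  proof -
    obtain a b c d where box: "a < b" "c < d" "N = cbox (a, c) (b, d)"
      using t_mesh_cellE[OF S N(1)] .
    have "closed_segment p (p + t *\<^sub>R e) \<subseteq> frontier N"
      using closed_segment_cbox_side[of p a c b d "p + t *\<^sub>R e"] box e corner[OF N]
      by (auto simp: directions_def)
    then show ?thesis
      using N e unfolding mesh_vertices_def mesh_grid_def by blast
  qed
  have "\<exists>t>0. p + t *\<^sub>R e \<in> mesh_vertices S \<and> closed_segment p (p + t *\<^sub>R e) \<subseteq> mesh_grid S"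
    if e: "e \<in> directions" for e
  proof -
    consider "e = (1, 0)" | "e = (-1, 0)" | "e = (0, 1)" | "e = (0, -1)"
      using e by (auto simp: directions_def)
    then show ?thesis
    proof cases
      case 1 show ?thesis
        by (rule arm[OF K(1,3), of "b - a"]) (use 1 e abcd pK xy corners_cbox in auto)
    next
      case 2 show ?thesis
        by (rule arm[OF L(1,3), of "b' - a'"]) (use 2 e abcd' pL xy corners_cbox in auto)
    next
      case 3 show ?thesis
        by (rule arm[OF K(1,3), of "d - c"]) (use 3 e abcd pK xy corners_cbox in auto)
    next
      case 4 show ?thesis
        by (rule arm[OF L(1,3), of "d' - c'"]) (use 4 e abcd' pL xy corners_cbox in auto)
    qed
  qed
  then have "card {E \<in> mesh_edges S. p \<in> E} = 4"
    by (rule card_edges_at_vertex[OF S pv])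
  then show ?thesis
    using pv p unfolding crossing_vertices_def by blast
qed

section \<open>The maximum principle\<close>

lemma bilinear_on_sum:
  assumes "\<And>i. i \<in> I \<Longrightarrow> bilinear_on K (f i)"
  shows "bilinear_on K (\<lambda>p. \<Sum>i\<in>I. f i p)"
proof -
  obtain a b c d
    where "\<And>i x y. i \<in> I \<Longrightarrow> (x, y) \<in> K \<Longrightarrow> f i (x, y) = a i + b i * x + c i * y + d i * x * y"
    using assms unfolding bilinear_on_def by metis
  then have "(\<Sum>i\<in>I. f i (x, y)) = sum a I + sum b I * x + sum c I * y + sum d I * x * y"
    if "(x, y) \<in> K" for x y
    using that by (simp add: sum.distrib sum_distrib_right)
  then show ?thesis
    unfolding bilinear_on_def by blast
qed

lemma bilinear_on_uminus:
  assumes "bilinear_on K f"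
  shows "bilinear_on K (\<lambda>p. - f p)"
proof -
  obtain a b c d where "\<And>x y. (x, y) \<in> K \<Longrightarrow> f (x, y) = a + b * x + c * y + d * x * y"
    using assms unfolding bilinear_on_def by blast
  then have "- f (x, y) = - a + (- b) * x + (- c) * y + (- d) * x * y" if "(x, y) \<in> K" for x y
    using that by simp
  then show ?thesis
    unfolding bilinear_on_def by blast
qed

lemma bilinear_on_midpoint:
  assumes "bilinear_on K f" "(x - h, y - k) \<in> K" "(x, y) \<in> K" "(x + h, y + k) \<in> K" "h * k = 0"
  shows "f (x - h, y - k) + f (x + h, y + k) = 2 * f (x, y)"
proof -
  obtain a b c d where *: "\<And>x y. (x, y) \<in> K \<Longrightarrow> f (x, y) = a + b * x + c * y + d * x * y"
    using assms(1) unfolding bilinear_on_def by blast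
  show ?thesis
    using assms(5) unfolding *[OF assms(2)] *[OF assms(3)] *[OF assms(4)]
    by (auto simp: algebra_simps)
qed

text \<open>The hypothesis \<open>lines\<close> concerns the full lines within the mesh, not just the sides of
  \<open>\<Omega>\<close>: otherwise a cell above \<open>\<Omega>\<close> could have a corner of \<open>\<Omega>\<close> inside its lower side, and the
  value at this corner would depend on values outside \<open>\<Omega>\<close>.\<close>

lemma spline_le_if_le_at_crossing_vertices:
  fixes f :: "real \<times> real \<Rightarrow> real"
  assumes S: "t_mesh S" and cont: "continuous_on UNIV f"
    and bil: "\<And>K. K \<in> S \<Longrightarrow> bilinear_on K f"
    and inside: "cbox (A, C) (B, D) \<subseteq> interior (\<Union>S)"
    and lines: "\<Union>S \<inter> {(x, y). x \<in> {A, B} \<or> y \<in> {C, D}} \<subseteq> mesh_grid S"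
    and cross: "\<And>p. p \<in> crossing_vertices S \<Longrightarrow> f p \<le> m"
    and z: "z \<in> cbox (A, C) (B, D)"
  shows "f z \<le> m"
proof -
  let ?\<Omega> = "cbox (A, C) (B, D)"
  have contf: "continuous_on X f" for X
    using cont continuous_on_subset by blast
  obtain p0 where p0: "p0 \<in> ?\<Omega>" "\<And>q. q \<in> ?\<Omega> \<Longrightarrow> f q \<le> f p0"
    using continuous_attains_sup[OF compact_cbox _ contf] z by blast
  define Z where "Z = ?\<Omega> \<inter> f -` {f p0}"
  have "compact Z"
    unfolding Z_def by (intro compact_Int_closed compact_cbox continuous_closed_vimage)
      (use cont in \<open>auto simp: continuous_on_eq_continuous_at\<close>)
  moreover have "Z \<noteq> {}"
    using p0 by (auto simp: Z_def)
  moreover have "continuous_on Z (\<lambda>p. fst p + snd p)"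
    by (intro continuous_intros)
  ultimately obtain p where p: "p \<in> Z" "\<And>q. q \<in> Z \<Longrightarrow> fst q + snd q \<le> fst p + snd p"
    using continuous_attains_sup[of Z "\<lambda>p. fst p + snd p"] by blast
  obtain x y where xy: "p = (x, y)"
    by fastforce
  have in\<Omega>: "(x, y) \<in> ?\<Omega>" and fxy: "f (x, y) = f p0"
    using p(1) xy by (auto simp: Z_def)
  \<comment> \<open>By the choice of \<open>p\<close>, the function is not affine on an axis-parallel segment centred there.\<close>
  have no_segment: False
    if K: "K \<in> S" "(x, y) \<in> K" and hk: "h * k = 0" "h + k > 0"
      and ends: "(x - h, y - k) \<in> K \<inter> ?\<Omega>" "(x + h, y + k) \<in> K \<inter> ?\<Omega>" for K h k
  proof -
    have "f (x - h, y - k) + f (x + h, y + k) = 2 * f (x, y)"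
      using bilinear_on_midpoint[OF bil[OF K(1)]] K(2) hk(1) ends by blast
    moreover have "f (x - h, y - k) \<le> f p0" "f (x + h, y + k) \<le> f p0"
      using p0(2) ends by auto
    ultimately have "(x + h, y + k) \<in> Z"
      using fxy ends by (auto simp: Z_def)
    then show False
      using p(2)[of "(x + h, y + k)"] hk(2) by (simp add: xy)
  qed
  have "p \<in> crossing_vertices S"
  proof (rule ccontr)
    assume "p \<notin> crossing_vertices S"
    then obtain K where K: "K \<in> S" "p \<in> K" "p \<notin> corners K"
      using crossing_vertex_if_always_corner[OF S] in\<Omega> inside xy by blast
    obtain a b c d where abcd: "a < b" "c < d" "K = cbox (a, c) (b, d)"
      using t_mesh_cellE[OF S K(1)] .
    have int: "interior K = {a<..<b} \<times> {c<..<d}"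
      unfolding abcd by (auto simp: interior_cbox mem_box Basis_prod_def)
    have off_grid: "(s, t) \<notin> mesh_grid S \<and> (s, t) \<in> \<Union>S" if "a < s" "s < b" "c < t" "t < d" for s t
    proof -
      have "(s, t) \<in> interior K"
        using that int by simp
      then show ?thesis
        using interior_cell_disjoint_mesh_grid[OF S K(1)] interior_subset[of K] K(1) by blast
    qed
    have le: "a \<le> x" "x \<le> b" "c \<le> y" "y \<le> d" "A \<le> x" "x \<le> B" "C \<le> y" "y \<le> D"
      using K(2) in\<Omega> xy abcd by (auto simp: cbox_Pair_eq)
    have "a < x \<and> x < b \<or> c < y \<and> y < d"
      using K(3) le abcd corners_cbox xy by auto
    then show False
    proof
      assume x: "a < x \<and> x < b"
      have "(x, (c + d) / 2) \<in> \<Union>S - mesh_grid S"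
        using off_grid[of x "(c + d) / 2"] x abcd(2) by simp
      then have "x \<notin> {A, B}"
        using lines by blast
      then have "A < x" "x < B"
        using le by auto
      define h where "h = Min {x - a, b - x, x - A, B - x}"
      have "h > 0" "h \<le> x - a" "h \<le> b - x" "h \<le> x - A" "h \<le> B - x"
        using x \<open>A < x\<close> \<open>x < B\<close> by (auto simp: h_def)
      then show False
        using no_segment[of K h 0] K le abcd xy by (auto simp: cbox_Pair_eq)
    next
      assume y: "c < y \<and> y < d"
      have "((a + b) / 2, y) \<in> \<Union>S - mesh_grid S"
        using off_grid[of "(a + b) / 2" y] y abcd(1) by simp
      then have "y \<notin> {C, D}"
        using lines by blast
      then have "C < y" "y < D"
        using le by auto
      define k where "k = Min {y - c, d - y, y - C, D - y}"
      have "k > 0" "k \<le> y - c" "k \<le> d - y" "k \<le> y - C" "k \<le> D - y"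
        using y \<open>C < y\<close> \<open>y < D\<close> by (auto simp: k_def)
      then show False
        using no_segment[of K 0 k] K le abcd xy by (auto simp: cbox_Pair_eq)
    qed
  qed
  then have "f p \<le> m"
    by (rule cross)
  then show ?thesis
    using p0(2)[OF z] fxy xy by simp
qed

section \<open>The frame\<close>

lemma tensor_mesh_4_cell:
  assumes "xs 0 \<le> x" "x \<le> xs 3" "ys 0 \<le> y" "y \<le> ys 3"
  obtains i j where "i < 3" "j < 3" "xs i \<le> x" "x \<le> xs (Suc i)" "ys j \<le> y" "y \<le> ys (Suc j)"
    "cbox (xs i, ys j) (xs (Suc i), ys (Suc j)) \<in> tensor_mesh 4 4 xs ys"
proof -
  have pick: "\<exists>i<3. zs i \<le> t \<and> t \<le> zs (Suc i)" if "zs 0 \<le> t" "t \<le> zs 3" for zs :: "nat \<Rightarrow> real" and t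
  proof -
    consider "t \<le> zs 1" | "zs 1 \<le> t" "t \<le> zs 2" | "zs 2 \<le> t"
      by linarith
    then show ?thesis
    proof cases
      case 1 then show ?thesis using that by (intro exI[of _ 0]) auto
    next
      case 2 then show ?thesis by (intro exI[of _ 1]) (auto simp: numeral_2_eq_2)
    next
      case 3 then show ?thesis using that by (intro exI[of _ 2]) (auto simp: numeral_3_eq_3 numeral_2_eq_2)
    qed
  qed
  obtain i where i: "i < 3" "xs i \<le> x" "x \<le> xs (Suc i)"
    using pick assms(1,2) by blast
  obtain j where j: "j < 3" "ys j \<le> y" "y \<le> ys (Suc j)"
    using pick assms(3,4) by blast
  have "cbox (xs i, ys j) (xs (Suc i), ys (Suc j)) \<in> tensor_mesh 4 4 xs ys"
    unfolding tensor_mesh_def using i(1) j(1) by force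
  with i j show thesis
    using that by blast
qed

lemma frame_mesh_lines:
  assumes "frame_mesh \<Omega> M"
  obtains A C B D where "\<Omega> = cbox (A, C) (B, D)" "\<Omega> \<subseteq> interior (\<Union>M)"
    "\<Union>M \<inter> {(x, y). x \<in> {A, B} \<or> y \<in> {C, D}} \<subseteq> mesh_grid M"
proof -
  obtain xs ys where xs: "strict_mono_on {..<4} xs" and ys: "strict_mono_on {..<4} ys"
    and M: "M = tensor_mesh 4 4 xs ys" and \<Omega>: "\<Omega> = cbox (xs 1, ys 1) (xs 2, ys 2)"
    using assms unfolding frame_mesh_def by blast
  have x: "xs 0 < xs 1" "xs 1 < xs 2" "xs 2 < xs 3" and y: "ys 0 < ys 1" "ys 1 < ys 2" "ys 2 < ys 3"
    using xs ys by (auto simp: strict_mono_on_def)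
  have UM: "\<Union>M = cbox (xs 0, ys 0) (xs 3, ys 3)"
  proof
    show "\<Union>M \<subseteq> cbox (xs 0, ys 0) (xs 3, ys 3)"
    proof
      fix q assume "q \<in> \<Union>M"
      then obtain i j where q: "Suc i < 4" "Suc j < 4" "q \<in> cbox (xs i, ys j) (xs (Suc i), ys (Suc j))"
        unfolding M tensor_mesh_def by blast
      have "xs 0 \<le> xs i" "xs (Suc i) \<le> xs 3" "ys 0 \<le> ys j" "ys (Suc j) \<le> ys 3"
        using strict_mono_on_leD[OF xs] strict_mono_on_leD[OF ys] q(1,2) by auto
      then show "q \<in> cbox (xs 0, ys 0) (xs 3, ys 3)"
        using q(3) by (auto simp: cbox_Pair_eq)
    qed
    show "cbox (xs 0, ys 0) (xs 3, ys 3) \<subseteq> \<Union>M"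
    proof
      fix q assume "q \<in> cbox (xs 0, ys 0) (xs 3, ys 3)"
      then obtain s t where st: "q = (s, t)" "xs 0 \<le> s" "s \<le> xs 3" "ys 0 \<le> t" "t \<le> ys 3"
        by (auto simp: cbox_Pair_eq)
      obtain i j where ij: "xs i \<le> s" "s \<le> xs (Suc i)" "ys j \<le> t" "t \<le> ys (Suc j)"
        "cbox (xs i, ys j) (xs (Suc i), ys (Suc j)) \<in> M"
        using tensor_mesh_4_cell[OF st(2-5)] unfolding M .
      then have "q \<in> cbox (xs i, ys j) (xs (Suc i), ys (Suc j))"
        by (simp add: st(1) cbox_Pair_eq)
      then show "q \<in> \<Union>M"
        using ij(5) by blast
    qed
  qed
  have "\<Omega> \<subseteq> interior (\<Union>M)"
    unfolding UM \<Omega> interior_cbox using x y by (auto simp: mem_box Basis_prod_def)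
  moreover have "(s, t) \<in> mesh_grid M"
    if "(s, t) \<in> \<Union>M" and st: "s \<in> {xs 1, xs 2} \<or> t \<in> {ys 1, ys 2}" for s t
  proof -
    have bounds: "xs 0 \<le> s" "s \<le> xs 3" "ys 0 \<le> t" "t \<le> ys 3"
      using that(1) unfolding UM by (auto simp: cbox_Pair_eq)
    obtain i j where ij: "i < 3" "j < 3" "xs i \<le> s" "s \<le> xs (Suc i)" "ys j \<le> t" "t \<le> ys (Suc j)"
      "cbox (xs i, ys j) (xs (Suc i), ys (Suc j)) \<in> M"
      using tensor_mesh_4_cell[OF bounds] unfolding M .
    \<comment> \<open>No line index lies strictly between \<open>i\<close> and \<open>Suc i\<close>.\<close>
    have on_line: "t = zs i \<or> t = zs (Suc i)"
      if zs: "strict_mono_on {..<4} zs" and t: "i < 3" "zs i \<le> t" "t \<le> zs (Suc i)" "t \<in> {zs 1, zs 2}"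
      for zs :: "nat \<Rightarrow> real" and i t
    proof -
      obtain l where l: "t = zs l" "l < 4"
        using t(4) by auto
      then have "i \<le> l" "l \<le> Suc i"
        using t(1-3) strict_mono_on_less_eq[OF zs] by auto
      then show ?thesis
        using l by (auto simp: le_Suc_eq)
    qed
    have "s = xs i \<or> s = xs (Suc i) \<or> t = ys j \<or> t = ys (Suc j)"
      using st on_line[OF xs ij(1,3,4)] on_line[OF ys ij(2,5,6)] by blast
    then have "(s, t) \<in> frontier (cbox (xs i, ys j) (xs (Suc i), ys (Suc j)))"
      using ij(3-6) unfolding mem_frontier_cbox_Pair by (simp add: cbox_Pair_eq)
    then show ?thesis
      using ij(7) unfolding mesh_grid_def by blast
  qed
  then have "\<Union>M \<inter> {(s, t). s \<in> {xs 1, xs 2} \<or> t \<in> {ys 1, ys 2}} \<subseteq> mesh_grid M"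
    by blast
  ultimately show thesis
    by (rule that[OF \<Omega>])
qed

section \<open>The partition of unity\<close>

theorem theorem3p5:
  fixes T M Te :: "(real \<times> real) set set"
    and \<Omega> :: "(real \<times> real) set"
    and V :: nat
    and v :: "nat \<Rightarrow> real \<times> real"
    and b :: "nat \<Rightarrow> real \<times> real \<Rightarrow> real"
  assumes "regular_t_mesh T" and "\<Union>T = \<Omega>"
    and "is_extension M T Te"
    and "bij_betw v {1..V} (crossing_vertices Te)"
    and "\<And>i. i \<in> {1..V} \<Longrightarrow> b i \<in> Sbar_1100 Te"
    and "\<And>i j. i \<in> {1..V} \<Longrightarrow> j \<in> {1..V} \<Longrightarrow> b i (v j) = (if i = j then 1 else 0)"
  shows "\<forall>(x, y)\<in>\<Omega>. (\<Sum>i = 1..V. b i (x, y)) = 1"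
proof -
  define f where "f p = (\<Sum>i = 1..V. b i p)" for p
  have frame: "frame_mesh \<Omega> M" and Te: "t_mesh Te" and UTe: "\<Union>Te = \<Union>M"
    and grid: "mesh_grid M \<subseteq> mesh_grid Te"
    using assms(3) unfolding is_extension_def regular_t_mesh_def assms(2) by (simp_all add: Un_assoc)
  obtain A C B D where \<Omega>: "\<Omega> = cbox (A, C) (B, D)" and inside: "\<Omega> \<subseteq> interior (\<Union>M)"
    and lines: "\<Union>M \<inter> {(x, y). x \<in> {A, B} \<or> y \<in> {C, D}} \<subseteq> mesh_grid M"
    using frame_mesh_lines[OF frame] .
  have cont: "continuous_on UNIV f"
    unfolding f_def using assms(5) by (intro continuous_on_sum) (auto simp: Sbar_1100_def)
  have bil: "bilinear_on K f" if "K \<in> Te" for K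
    unfolding f_def using assms(5) that by (intro bilinear_on_sum) (auto simp: Sbar_1100_def)
  have cross: "f p = 1" if "p \<in> crossing_vertices Te" for p
  proof -
    have "p \<in> v ` {1..V}"
      using that unfolding bij_betw_imp_surj_on[OF assms(4)] .
    then obtain j where j: "p = v j" "j \<in> {1..V}" ..
    have "f p = (\<Sum>i = 1..V. if i = j then 1 else 0)"
      unfolding f_def j(1) by (rule sum.cong[OF refl]) (rule assms(6)[OF _ j(2)])
    then show ?thesis
      using j(2) by simp
  qed
  have inside': "cbox (A, C) (B, D) \<subseteq> interior (\<Union>Te)"
    using inside UTe \<Omega> by simp
  have lines': "\<Union>Te \<inter> {(x, y). x \<in> {A, B} \<or> y \<in> {C, D}} \<subseteq> mesh_grid Te"
    using lines grid unfolding UTe by (rule subset_trans)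
  have "f p = 1" if "p \<in> \<Omega>" for p
  proof -
    have "f p \<le> 1"
      by (rule spline_le_if_le_at_crossing_vertices[OF Te cont bil inside' lines'])
        (use cross that \<Omega> in simp_all)
    moreover have "- f p \<le> - 1"
      by (rule spline_le_if_le_at_crossing_vertices[OF Te _ _ inside' lines'])
        (use cross that \<Omega> in \<open>simp_all add: bil cont bilinear_on_uminus continuous_on_minus\<close>)
    ultimately show ?thesis
      by simp
  qed
  then show ?thesis
    by (auto simp: f_def)
qed

end
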